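(* Let $n\ge 0$, let $\phi=\{\phi_k\}_{k=0}^n$ be a basis of the space of univariate (real or complex) polynomials of degree at most $n$, and let $\mathbf{D}$ be the differentiation matrix in this basis. Let $\mathbf{V}$ be the (invertible) $(n+1)\times(n+1)$ matrix whose $k$-th column (numbered from $0$ to $n$) is $\frac{1}{k!}\mathbf{X}_\phi^k$, where $\mathbf{X}_\phi^k$ is the coefficient vector of $x^k$ in the basis $\phi$. Let $\mathbf{J}$ be the $(n+1)\times(n+1)$ matrix with ones on the first superdiagonal and zeros elsewhere, and let $\mathbf{J}^+$ be its Moore–Penrose pseudo-inverse. Then the matrix $$\mathbf{D}^+=\mathbf{V}\mathbf{J}^+\mathbf{V}^{-1}$$ is a generalized inverse of $\mathbf{D}$, that is, $\mathbf{D}^+\mathbf{D}\mathbf{D}^+=\mathbf{D}^+$ and $\mathbf{D}\mathbf{D}^+\mathbf{D}=\mathbf{D}$.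
   Context: The differentiation matrix $\mathbf{D}$ is the $(n+1)\times(n+1)$ matrix such that if $f=\sum_{k=0}^n a_k\phi_k$ and $f'=\sum_{k=0}^n b_k\phi_k$ then $\mathbf{b}=\mathbf{D}\mathbf{a}$, where $\mathbf{a}=[a_0,\ldots,a_n]^T$ and $\mathbf{b}=[b_0,\ldots,b_n]^T$. The basis is not assumed to be degree-graded. If $x^k=b_{k,0}\phi_0(x)+\cdots+b_{k,n}\phi_n(x)$, then $\mathbf{X}_\phi^k=[b_{k,0},\ldots,b_{k,n}]^T$. "Generalized inverse" means that the first two Moore–Penrose conditions (the two identities in the claim) hold; Hermitian symmetry of $\mathbf{D}^+\mathbf{D}$ and $\mathbf{D}\mathbf{D}^+$ is not required. *)

theory Defs
  imports
    Complex_Main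
    "HOL-Computational_Algebra.Polynomial"
    "Jordan_Normal_Form.Matrix"
    "Jordan_Normal_Form.Conjugate"
    "Jordan_Normal_Form.Gauss_Jordan_Elimination"
    "Jordan_Normal_Form.Schur_Decomposition"
begin

(* Bases and coordinates are indexed by {..n}, so vectors have dimension Suc n.
   Functions nat => 'a poly are only ever inspected on {..n}. *)

interpretation poly_vs: vector_space "Polynomial.smult :: 'a::field \<Rightarrow> 'a poly \<Rightarrow> 'a poly"
  by unfold_locales (simp_all add: Polynomial.smult_add_right Polynomial.smult_add_left)

definition poly_basis :: "nat \<Rightarrow> (nat \<Rightarrow> 'a::field poly) \<Rightarrow> bool" where
  "poly_basis n \<phi> \<longleftrightarrow>
     inj_on \<phi> {..n} \<and> poly_vs.independent (\<phi> ` {..n}) \<and>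
     poly_vs.span (\<phi> ` {..n}) = {p. degree p \<le> n}"

definition lincomb_poly :: "nat \<Rightarrow> (nat \<Rightarrow> 'a::comm_ring_1 poly) \<Rightarrow> 'a vec \<Rightarrow> 'a poly" where
  "lincomb_poly n \<phi> a = (\<Sum>k\<le>n. Polynomial.smult (a $ k) (\<phi> k))"

definition coord_vec :: "nat \<Rightarrow> (nat \<Rightarrow> 'a::comm_ring_1 poly) \<Rightarrow> 'a poly \<Rightarrow> 'a vec" where
  "coord_vec n \<phi> p = (THE b. b \<in> carrier_vec (Suc n) \<and> p = lincomb_poly n \<phi> b)"

definition diff_mat :: "nat \<Rightarrow> (nat \<Rightarrow> 'a::idom poly) \<Rightarrow> 'a mat" where
  "diff_mat n \<phi> = (THE D. D \<in> carrier_mat (Suc n) (Suc n) \<and>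
     (\<forall>a\<in>carrier_vec (Suc n). \<forall>b\<in>carrier_vec (Suc n).
        pderiv (lincomb_poly n \<phi> a) = lincomb_poly n \<phi> b \<longrightarrow> b = D *\<^sub>v a))"

definition monomial_mat :: "nat \<Rightarrow> (nat \<Rightarrow> 'a::field_char_0 poly) \<Rightarrow> 'a mat" where
  "monomial_mat n \<phi> = mat_of_cols (Suc n)
     (map (\<lambda>k. (1 / fact k) \<cdot>\<^sub>v coord_vec n \<phi> (Polynomial.monom 1 k)) [0..<Suc n])"

definition superdiag_mat :: "nat \<Rightarrow> 'a::zero_neq_one mat" where
  "superdiag_mat n = mat (Suc n) (Suc n) (\<lambda>(i, j). if j = Suc i then 1 else 0)"

definition is_moore_penrose :: "'a::conjugatable_field mat \<Rightarrow> 'a mat \<Rightarrow> bool" where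
  "is_moore_penrose A B \<longleftrightarrow>
     B \<in> carrier_mat (dim_col A) (dim_row A) \<and>
     A * B * A = A \<and> B * A * B = B \<and>
     mat_adjoint (A * B) = A * B \<and> mat_adjoint (B * A) = B * A"

definition moore_penrose_inverse :: "'a::conjugatable_field mat \<Rightarrow> 'a mat" where
  "moore_penrose_inverse A = (THE B. is_moore_penrose A B)"

end

(* The columns of V are the coordinates of the Taylor basis x^k / k!,
   on which differentiation is the shift; hence D = V J V^-1.  The identities for D and Dp are
   therefore conjugates by V of the Penrose identities for J and its pseudo-inverse, the
   transpose of J. *)
theory Submission
  imports Defs
begin

section \<open>Coordinates with respect to a polynomial basis\<close>

lemma lincomb_poly_diff:
  assumes "a \<in> carrier_vec (Suc n)" "b \<in> carrier_vec (Suc n)"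
  shows "lincomb_poly n \<phi> (a - b) = lincomb_poly n \<phi> a - lincomb_poly n \<phi> b"
  using assms unfolding lincomb_poly_def
  by (simp add: sum_subtractf[symmetric] Polynomial.smult_diff_left)

text \<open>Independence speaks of a set of polynomials, coordinates of an index range. Injectivity
  of \<open>\<phi>\<close> on \<open>{..n}\<close> turns the vector \<open>a - b\<close> into a
  coefficient function \<open>c\<close> on that set.\<close>

lemma lincomb_poly_inj:
  fixes \<phi> :: "nat \<Rightarrow> 'a::field poly"
  assumes basis: "poly_basis n \<phi>"
    and a: "a \<in> carrier_vec (Suc n)" and b: "b \<in> carrier_vec (Suc n)"
    and eq: "lincomb_poly n \<phi> a = lincomb_poly n \<phi> b"
  shows "a = b"
proof -
  have inj: "inj_on \<phi> {..n}" and ind: "poly_vs.independent (\<phi> ` {..n})"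
    using basis unfolding poly_basis_def by auto
  define c where "c v = (a - b) $ the_inv_into {..n} \<phi> v" for v
  have c: "c (\<phi> k) = (a - b) $ k" if "k \<le> n" for k
    using that by (simp add: c_def the_inv_into_f_f[OF inj])
  have "(\<Sum>v\<in>\<phi> ` {..n}. Polynomial.smult (c v) v) = lincomb_poly n \<phi> (a - b)"
    unfolding lincomb_poly_def by (simp add: sum.reindex[OF inj] c)
  also have "\<dots> = 0"
    using eq by (simp add: lincomb_poly_diff[OF a b])
  finally have zero: "(\<Sum>v\<in>\<phi> ` {..n}. Polynomial.smult (c v) v) = 0" .
  have "(a - b) $ k = 0" if "k \<le> n" for k
    using poly_vs.independentD[OF ind _ subset_refl zero, of "\<phi> k"] c[OF that] that by simp
  then show ?thesis
    using a b by (intro eq_vecI) (auto simp: less_Suc_eq_le)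
qed

lemma lincomb_poly_surj:
  fixes \<phi> :: "nat \<Rightarrow> 'a::field poly"
  assumes basis: "poly_basis n \<phi>" and deg: "degree p \<le> n"
  obtains a where "a \<in> carrier_vec (Suc n)" "p = lincomb_poly n \<phi> a"
proof -
  have inj: "inj_on \<phi> {..n}" and "p \<in> poly_vs.span (\<phi> ` {..n})"
    using basis deg unfolding poly_basis_def by auto
  then obtain u where "p = (\<Sum>v\<in>\<phi> ` {..n}. Polynomial.smult (u v) v)"
    by (auto simp: poly_vs.span_finite)
  also have "\<dots> = lincomb_poly n \<phi> (vec (Suc n) (\<lambda>k. u (\<phi> k)))"
    unfolding lincomb_poly_def by (simp add: sum.reindex[OF inj])
  finally show thesis
    by (intro that) auto
qed

lemma degree_lincomb_poly:
  fixes \<phi> :: "nat \<Rightarrow> 'a::field poly"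
  assumes "poly_basis n \<phi>"
  shows "degree (lincomb_poly n \<phi> a) \<le> n"
proof -
  have "lincomb_poly n \<phi> a \<in> poly_vs.span (\<phi> ` {..n})"
    unfolding lincomb_poly_def
    by (intro poly_vs.span_sum poly_vs.span_scale poly_vs.span_base) auto
  then show ?thesis
    using assms unfolding poly_basis_def by auto
qed

text \<open>Existence and uniqueness of coordinates make the definite description in
  \<open>coord_vec\<close> meaningful.\<close>

lemma coord_vec:
  fixes \<phi> :: "nat \<Rightarrow> 'a::field poly"
  assumes basis: "poly_basis n \<phi>" and deg: "degree p \<le> n"
  shows "coord_vec n \<phi> p \<in> carrier_vec (Suc n)"
    and "lincomb_poly n \<phi> (coord_vec n \<phi> p) = p"
proof -
  obtain a where a: "a \<in> carrier_vec (Suc n)" "p = lincomb_poly n \<phi> a"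
    by (rule lincomb_poly_surj[OF basis deg])
  have "coord_vec n \<phi> p = a"
    unfolding coord_vec_def
    by (rule the_equality) (use a lincomb_poly_inj[OF basis] in auto)
  with a show "coord_vec n \<phi> p \<in> carrier_vec (Suc n)"
    and "lincomb_poly n \<phi> (coord_vec n \<phi> p) = p" by auto
qed

section \<open>Matrices determined by their action on coordinate vectors\<close>

lemma mult_mat_vec_ext:
  fixes A B :: "'a::semiring_1 mat"
  assumes A: "A \<in> carrier_mat m n" and B: "B \<in> carrier_mat m n"
    and eq: "\<And>v. v \<in> carrier_vec n \<Longrightarrow> A *\<^sub>v v = B *\<^sub>v v"
  shows "A = B"
proof (rule eq_matI)
  fix i j assume ij: "i < dim_row B" "j < dim_col B"
  have entry: "(M *\<^sub>v unit_vec n j) $ i = M $$ (i, j)" if "M \<in> carrier_mat m n" for M :: "'a mat"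
    using that ij B by simp
  show "A $$ (i, j) = B $$ (i, j)"
    using entry[OF A] entry[OF B] by (simp add: eq)
qed (use A B in auto)

text \<open>Injectivity of \<open>lincomb_poly\<close> shows that such an \<open>A\<close> meets the
  defining implication of \<open>diff_mat\<close>. A rival \<open>B\<close> must agree with it,
  since \<open>A *\<^sub>v a\<close> is an admissible choice of \<open>b\<close> for every
  \<open>a\<close>.\<close>

lemma diff_mat_eqI:
  fixes \<phi> :: "nat \<Rightarrow> 'a::field poly"
  assumes basis: "poly_basis n \<phi>" and A: "A \<in> carrier_mat (Suc n) (Suc n)"
    and deriv: "\<And>a. a \<in> carrier_vec (Suc n) \<Longrightarrow>
      pderiv (lincomb_poly n \<phi> a) = lincomb_poly n \<phi> (A *\<^sub>v a)"
  shows "diff_mat n \<phi> = A"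
  unfolding diff_mat_def
proof (rule the_equality)
  show "A \<in> carrier_mat (Suc n) (Suc n) \<and>
     (\<forall>a\<in>carrier_vec (Suc n). \<forall>b\<in>carrier_vec (Suc n).
        pderiv (lincomb_poly n \<phi> a) = lincomb_poly n \<phi> b \<longrightarrow> b = A *\<^sub>v a)"
    using A deriv lincomb_poly_inj[OF basis] by (metis mult_mat_vec_carrier)
next
  fix B :: "'a mat"
  assume B: "B \<in> carrier_mat (Suc n) (Suc n) \<and>
     (\<forall>a\<in>carrier_vec (Suc n). \<forall>b\<in>carrier_vec (Suc n).
        pderiv (lincomb_poly n \<phi> a) = lincomb_poly n \<phi> b \<longrightarrow> b = B *\<^sub>v a)"
  show "B = A"
  proof (rule mult_mat_vec_ext)
    fix a :: "'a vec" assume a: "a \<in> carrier_vec (Suc n)"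
    show "B *\<^sub>v a = A *\<^sub>v a"
      using B[THEN conjunct2, rule_format, OF a mult_mat_vec_carrier[OF A a] deriv[OF a]] ..
  qed (use A B in auto)
qed

section \<open>The Taylor basis\<close>

lemma monomial_mat_carrier: "monomial_mat n \<phi> \<in> carrier_mat (Suc n) (Suc n)"
  unfolding monomial_mat_def carrier_mat_def by (simp del: upt_Suc)

lemma monomial_mat_index:
  assumes "poly_basis n \<phi>" "i \<le> n" "k \<le> n"
  shows "monomial_mat n \<phi> $$ (i, k) = coord_vec n \<phi> (Polynomial.monom 1 k) $ i / fact k"
proof -
  have "coord_vec n \<phi> (Polynomial.monom 1 k) \<in> carrier_vec (Suc n)"
    using assms by (intro coord_vec) (auto simp: Polynomial.degree_monom_eq)
  then show ?thesis
    using assms unfolding monomial_mat_def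
    by (simp add: mat_of_cols_index del: upt_Suc)
qed

text \<open>\<open>monomial_mat\<close> translates Taylor coordinates, taken with respect to x^k /
  k!, into coordinates with respect to \<open>\<phi>\<close>. All later facts about it go through
  this equation.\<close>

lemma lincomb_poly_monomial_mat:
  fixes \<phi> :: "nat \<Rightarrow> 'a::field_char_0 poly"
  assumes basis: "poly_basis n \<phi>" and c: "c \<in> carrier_vec (Suc n)"
  shows "lincomb_poly n \<phi> (monomial_mat n \<phi> *\<^sub>v c) =
    (\<Sum>k\<le>n. Polynomial.monom (c $ k / fact k) k)"
proof -
  let ?x = "\<lambda>k. coord_vec n \<phi> (Polynomial.monom 1 k)"
  have V: "(monomial_mat n \<phi> *\<^sub>v c) $ i = (\<Sum>k\<le>n. c $ k / fact k * ?x k $ i)"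
    if "i \<le> n" for i
    using that c monomial_mat_carrier[of n \<phi>]
    by (auto simp: scalar_prod_def monomial_mat_index[OF basis] atLeast0LessThan
        lessThan_Suc_atMost intro!: sum.cong)
  have "lincomb_poly n \<phi> (monomial_mat n \<phi> *\<^sub>v c) =
    (\<Sum>i\<le>n. \<Sum>k\<le>n. Polynomial.smult (c $ k / fact k) (Polynomial.smult (?x k $ i) (\<phi> i)))"
    unfolding lincomb_poly_def by (simp add: V Polynomial.smult_sum)
  \<comment> \<open>After the swap, the inner sum over i reassembles x^k from its
    coordinates.\<close>
  also have "\<dots> = (\<Sum>k\<le>n. Polynomial.smult (c $ k / fact k) (lincomb_poly n \<phi> (?x k)))"
    unfolding lincomb_poly_def by (subst sum.swap) (simp add: smult_sum2)
  also have "\<dots> = (\<Sum>k\<le>n. Polynomial.monom (c $ k / fact k) k)"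
    by (simp add: coord_vec(2)[OF basis] Polynomial.degree_monom_eq Polynomial.smult_monom)
  finally show ?thesis .
qed

lemma monomial_mat_right_inverse:
  fixes \<phi> :: "nat \<Rightarrow> 'a::field_char_0 poly"
  assumes basis: "poly_basis n \<phi>"
  obtains W where "W \<in> carrier_mat (Suc n) (Suc n)" "monomial_mat n \<phi> * W = 1\<^sub>m (Suc n)"
proof
  let ?V = "monomial_mat n \<phi>"
  \<comment> \<open>Column j lists the derivatives of \<open>\<phi> j\<close> at 0; the factor k!
    cancels the 1 / k! in \<open>?V\<close>.\<close>
  define W where "W = mat (Suc n) (Suc n) (\<lambda>(k, j). fact k * Polynomial.coeff (\<phi> j) k)"
  show W: "W \<in> carrier_mat (Suc n) (Suc n)"
    by (simp add: W_def)
  have W_mult: "(W *\<^sub>v a) $ k = fact k * Polynomial.coeff (lincomb_poly n \<phi> a) k"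
    if "k \<le> n" "a \<in> carrier_vec (Suc n)" for a k
    using that
    by (simp add: W_def scalar_prod_def lincomb_poly_def Polynomial.coeff_sum sum_distrib_left
        atLeast0LessThan lessThan_Suc_atMost algebra_simps del: sum.lessThan_Suc sum.atMost_Suc)
  show "?V * W = 1\<^sub>m (Suc n)"
  proof (rule mult_mat_vec_ext)
    fix a :: "'a vec" assume a: "a \<in> carrier_vec (Suc n)"
    have Wa: "W *\<^sub>v a \<in> carrier_vec (Suc n)"
      using W a by auto
    have "lincomb_poly n \<phi> (?V *\<^sub>v (W *\<^sub>v a)) =
        (\<Sum>k\<le>n. Polynomial.monom (Polynomial.coeff (lincomb_poly n \<phi> a) k) k)"
      by (simp add: lincomb_poly_monomial_mat[OF basis Wa] W_mult[OF _ a])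
    also have "\<dots> = lincomb_poly n \<phi> a"
      \<comment> \<open>Nothing is lost by stopping at k = n, because the degree is at most
        n.\<close>
      by (rule poly_as_sum_of_monoms'[OF degree_lincomb_poly[OF basis]])
    finally have "?V *\<^sub>v (W *\<^sub>v a) = a"
      using monomial_mat_carrier[of n \<phi>] Wa
      by (intro lincomb_poly_inj[OF basis _ a]) auto
    then show "?V * W *\<^sub>v a = 1\<^sub>m (Suc n) *\<^sub>v a"
      using a W monomial_mat_carrier[of n \<phi>] by simp
  qed (use W monomial_mat_carrier[of n \<phi>] in auto)
qed

text \<open>A one-sided inverse of a square matrix over a field is two-sided, so \<open>A\<close> is
  a unit and the result \<open>None\<close> is impossible. Any left inverse then equals
  \<open>B\<close> by associativity.\<close>

lemma mat_inverse_of_right_inverse: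
  fixes A :: "'a::field mat"
  assumes A: "A \<in> carrier_mat n n" and B: "B \<in> carrier_mat n n" and AB: "A * B = 1\<^sub>m n"
  shows "mat_inverse A = Some B"
proof (cases "mat_inverse A")
  case None
  have "B * A = 1\<^sub>m n"
    by (rule mat_mult_left_right_inverse[OF A B AB])
  then have "A \<in> Units (ring_mat TYPE('a) n undefined)"
    using A B AB by (auto simp: Units_def ring_mat_def)
  with mat_inverse(1)[OF A None, of undefined] show ?thesis
    by blast
next
  case (Some C)
  then have C: "C * A = 1\<^sub>m n" "C \<in> carrier_mat n n"
    using mat_inverse(2)[OF A] by auto
  have "C = C * (A * B)"
    using C AB by simp
  also have "\<dots> = B"
    using assoc_mult_mat[OF C(2) A B] C B by simp
  finally show ?thesis
    using Some by simp
qed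

section \<open>The shift matrix\<close>

lemma superdiag_mat_carrier: "superdiag_mat n \<in> carrier_mat (Suc n) (Suc n)"
  by (simp add: superdiag_mat_def)

lemma superdiag_mat_mult_vec:
  fixes c :: "'a::field vec"
  assumes "c \<in> carrier_vec (Suc n)" "i \<le> n"
  shows "(superdiag_mat n *\<^sub>v c) $ i = (if i < n then c $ Suc i else 0)"
  using assms by (simp add: superdiag_mat_def scalar_prod_def if_distrib[of "\<lambda>x. x * _"]
      cong: if_cong del: sum.op_ivl_Suc)

text \<open>The derivative of x^k / k! is x^(k-1) / (k-1)!, and that of 1 is 0, so differentiation
  moves every Taylor coordinate down by one place.\<close>

lemma diff_mat_monomial_mat:
  fixes \<phi> :: "nat \<Rightarrow> 'a::field_char_0 poly"
  assumes basis: "poly_basis n \<phi>"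
    and W: "W \<in> carrier_mat (Suc n) (Suc n)" and VW: "monomial_mat n \<phi> * W = 1\<^sub>m (Suc n)"
  shows "diff_mat n \<phi> = monomial_mat n \<phi> * superdiag_mat n * W"
proof (rule diff_mat_eqI[OF basis])
  let ?V = "monomial_mat n \<phi>" and ?J = "superdiag_mat n :: 'a mat"
  note carr = monomial_mat_carrier[of n \<phi>] superdiag_mat_carrier[of n, where 'a = 'a] W
  show "?V * ?J * W \<in> carrier_mat (Suc n) (Suc n)"
    using carr by auto
  fix a :: "'a vec" assume a: "a \<in> carrier_vec (Suc n)"
  \<comment> \<open>The Taylor coordinates of the polynomial whose \<open>\<phi>\<close>-coordinates
    are \<open>a\<close>.\<close>
  define c where "c = W *\<^sub>v a"
  have c: "c \<in> carrier_vec (Suc n)"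
    using carr a by (auto simp: c_def)
  then have Jc: "?J *\<^sub>v c \<in> carrier_vec (Suc n)"
    using carr by auto
  have "?V *\<^sub>v c = ?V * W *\<^sub>v a"
    using carr a by (simp add: c_def)
  then have Vc: "?V *\<^sub>v c = a"
    using a by (simp add: VW)
  have "pderiv (lincomb_poly n \<phi> a) = (\<Sum>k\<le>n. pderiv (Polynomial.monom (c $ k / fact k) k))"
    using lincomb_poly_monomial_mat[OF basis c] by (simp add: Vc pderiv_sum)
  also have "\<dots> = (\<Sum>k\<le>n. Polynomial.monom ((?J *\<^sub>v c) $ k / fact k) k)"
  proof (cases n)
    case (Suc m)
    \<comment> \<open>The constant term vanishes, and in the others the exponent k + 1 cancels
      against (k + 1)!.\<close>
    have "(\<Sum>k\<le>n. pderiv (Polynomial.monom (c $ k / fact k) k)) =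
        (\<Sum>k\<le>m. Polynomial.monom (c $ Suc k / fact k) k)"
      unfolding Suc sum.atMost_Suc_shift
      by (simp add: pderiv_monom field_simps del: of_nat_Suc)
    \<comment> \<open>The additional summand k = n is zero, since the last row of \<open>?J\<close>
      is zero.\<close>
    also have "\<dots> = (\<Sum>k\<le>n. Polynomial.monom ((?J *\<^sub>v c) $ k / fact k) k)"
      using c by (simp add: Suc superdiag_mat_mult_vec less_Suc_eq_le)
    finally show ?thesis .
  qed (use c in \<open>simp add: pderiv_monom superdiag_mat_mult_vec\<close>)
  also have "\<dots> = lincomb_poly n \<phi> (?V *\<^sub>v (?J *\<^sub>v c))"
    by (rule lincomb_poly_monomial_mat[OF basis Jc, symmetric])
  also have "?V *\<^sub>v (?J *\<^sub>v c) = ?V * ?J * W *\<^sub>v a"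
    using carr a c by (simp add: c_def assoc_mult_mat_vec[of _ "Suc n" "Suc n" _ "Suc n"])
  finally show "pderiv (lincomb_poly n \<phi> a) = lincomb_poly n \<phi> (?V * ?J * W *\<^sub>v a)" .
qed

section \<open>The Moore--Penrose inverse of the shift\<close>

text \<open>By multiplicativity the conjugate of 1 is idempotent. It is nonzero, as only 0 has
  conjugate 0, and a nonzero idempotent of a field is 1.\<close>

lemma conjugate_one: "conjugate (1 :: 'a::conjugatable_field) = 1"
proof -
  have "conjugate 1 * conjugate 1 = conjugate (1 :: 'a)"
    by (metis conjugate_dist_mul mult_1)
  then show ?thesis
    by (metis conjugate_zero_iff mult_cancel_left1 zero_neq_one)
qed

section \<open>Adjoints and uniqueness of the pseudo-inverse\<close>

lemma mat_adjoint_dim [simp]: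
  "dim_row (mat_adjoint A) = dim_col A" "dim_col (mat_adjoint A) = dim_row A"
  unfolding mat_adjoint_def by auto

lemma mat_adjoint_index:
  assumes "i < dim_col A" "j < dim_row A"
  shows "mat_adjoint A $$ (i, j) = conjugate (A $$ (j, i))"
  using assms unfolding mat_adjoint_def by (simp add: mat_of_rows_index)

lemma mat_adjoint_mult:
  assumes "A \<in> carrier_mat m k" "B \<in> carrier_mat k n"
  shows "mat_adjoint (A * B) = mat_adjoint B * mat_adjoint A"
  using assms
  by (intro eq_matI)
    (auto simp: mat_adjoint_index scalar_prod_def sum_conjugate conjugate_dist_mul mult.commute
      intro!: sum.cong)

text \<open>Penrose's argument: the self-adjoint projections satisfy AB = AC and BA = CA, whence B =
  BAB = CAB = CAC = C.\<close>

lemma moore_penrose_unique: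
  assumes B: "is_moore_penrose A B" and C: "is_moore_penrose A C"
  shows "B = C"
proof -
  let ?m = "dim_row A" and ?n = "dim_col A"
  have A: "A \<in> carrier_mat ?m ?n" by auto
  have Bc: "B \<in> carrier_mat ?n ?m" and Cc: "C \<in> carrier_mat ?n ?m"
    using B C unfolding is_moore_penrose_def by auto
  note mul = mult_carrier_mat[OF A Bc] mult_carrier_mat[OF A Cc]
    mult_carrier_mat[OF Bc A] mult_carrier_mat[OF Cc A]
  \<comment> \<open>Inserting ACA for A writes AB as a product of two self-adjoint factors; taking
    the adjoint reverses their order.\<close>
  have "A * B = mat_adjoint (A * C * A * B)"
    using B C unfolding is_moore_penrose_def by simp
  also have "A * C * A * B = (A * C) * (A * B)"
    by (rule assoc_mult_mat[OF mul(2) A Bc])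
  also have "mat_adjoint \<dots> = (A * B) * (A * C)"
    using B C unfolding mat_adjoint_mult[OF mul(2) mul(1)] is_moore_penrose_def by simp
  also have "\<dots> = A * C"
    using B assoc_mult_mat[OF mul(1) A Cc] unfolding is_moore_penrose_def by simp
  finally have AB: "A * B = A * C" .
  have "B * A = mat_adjoint (B * (A * C * A))"
    using B C unfolding is_moore_penrose_def by simp
  also have "B * (A * C * A) = (B * A) * (C * A)"
    by (simp only: assoc_mult_mat[OF A Cc A] assoc_mult_mat[OF Bc A mul(4)])
  also have "mat_adjoint \<dots> = (C * A) * (B * A)"
    using B C unfolding mat_adjoint_mult[OF mul(3) mul(4)] is_moore_penrose_def by simp
  also have "\<dots> = C * (A * B * A)"
    by (simp only: assoc_mult_mat[OF Cc A mul(3)] assoc_mult_mat[OF A Bc A])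
  also have "\<dots> = C * A"
    using B unfolding is_moore_penrose_def by simp
  finally have BA: "B * A = C * A" .
  have "B = B * A * B"
    using B unfolding is_moore_penrose_def by simp
  also have "\<dots> = C * (A * B)"
    unfolding BA by (rule assoc_mult_mat[OF Cc A Bc])
  also have "\<dots> = C * A * C"
    unfolding AB by (rule assoc_mult_mat[OF Cc A Cc, symmetric])
  also have "\<dots> = C"
    using C unfolding is_moore_penrose_def by simp
  finally show ?thesis .
qed

lemma moore_penrose_inverse_eqI:
  assumes "is_moore_penrose A B"
  shows "moore_penrose_inverse A = B"
  unfolding moore_penrose_inverse_def
  using assms moore_penrose_unique by (blast intro: the_equality)

text \<open>The shift is a partial isometry: both products with its transpose are diagonal with
  entries 0 and 1. Row n of \<open>?J\<close> is zero, so \<open>?J * ?T\<close> loses the last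
  diagonal entry; column 0 is zero, so \<open>?T * ?J\<close> loses the first.\<close>

lemma is_moore_penrose_superdiag_mat:
  "is_moore_penrose (superdiag_mat n) (transpose_mat (superdiag_mat n :: 'a::conjugatable_field mat))"
proof -
  let ?J = "superdiag_mat n :: 'a mat" and ?T = "transpose_mat (superdiag_mat n :: 'a mat)"
  let ?N = "Suc n"
  have JT: "?J * ?T = mat ?N ?N (\<lambda>(i, j). if i = j \<and> i < n then 1 else 0)"
    by (intro eq_matI)
      (auto simp: superdiag_mat_def scalar_prod_def if_distrib[of "\<lambda>x. x * _"]
        cong: if_cong simp del: sum.op_ivl_Suc)
  have TJ: "?T * ?J = mat ?N ?N (\<lambda>(i, j). if i = j \<and> 0 < i then 1 else 0)"
  proof (intro eq_matI)
    fix i j assume "i < dim_row (mat ?N ?N (\<lambda>(i, j). if i = j \<and> 0 < i then 1 else 0 :: 'a))"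
      "j < dim_col (mat ?N ?N (\<lambda>(i, j). if i = j \<and> 0 < i then 1 else 0 :: 'a))"
    then show "(?T * ?J) $$ (i, j) = mat ?N ?N (\<lambda>(i, j). if i = j \<and> 0 < i then 1 else 0) $$ (i, j)"
      \<comment> \<open>Entry (i, j) sums over the rows of \<open>?J\<close>; only row i - 1 can
        contribute, and for i = 0 there is none.\<close>
      by (cases i) (auto simp: superdiag_mat_def scalar_prod_def if_distrib[of "\<lambda>x. x * _"]
        cong: if_cong simp del: sum.op_ivl_Suc)
  qed (auto simp: superdiag_mat_def)
  have "?J * ?T * ?J = ?J"
    unfolding JT
    by (intro eq_matI)
      (auto simp: superdiag_mat_def scalar_prod_def if_distrib[of "\<lambda>x. x * _"]
        cong: if_cong simp del: sum.op_ivl_Suc)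
  moreover have "?T * ?J * ?T = ?T"
    unfolding TJ
    by (intro eq_matI)
      (auto simp: superdiag_mat_def scalar_prod_def if_distrib[of "\<lambda>x. x * _"]
        cong: if_cong simp del: sum.op_ivl_Suc)
  moreover have "mat_adjoint (?J * ?T) = ?J * ?T" "mat_adjoint (?T * ?J) = ?T * ?J"
    unfolding JT TJ by (auto intro!: eq_matI simp: mat_adjoint_index conjugate_one)
  ultimately show ?thesis
    unfolding is_moore_penrose_def by (auto simp: superdiag_mat_def)
qed

text \<open>Each inner pair \<open>W * V\<close> cancels, so conjugation by \<open>V\<close> carries
  the Penrose identities over.\<close>

lemma similar_mat_mult3:
  fixes V W A B C :: "'a::comm_semiring_1 mat"
  assumes V: "V \<in> carrier_mat n n" and W: "W \<in> carrier_mat n n" and WV: "W * V = 1\<^sub>m n"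
    and A: "A \<in> carrier_mat n n" and B: "B \<in> carrier_mat n n" and C: "C \<in> carrier_mat n n"
  shows "(V * A * W) * (V * B * W) * (V * C * W) = V * (A * B * C) * W"
proof -
  have two: "(V * P * W) * (V * Q * W) = V * (P * Q) * W"
    if P: "P \<in> carrier_mat n n" and Q: "Q \<in> carrier_mat n n" for P Q
  proof -
    have "(V * P * W) * (V * Q * W) = V * P * ((W * V) * (Q * W))"
      using V W P Q by (simp add: assoc_mult_mat[of _ n n _ n _ n])
    also have "\<dots> = V * (P * Q) * W"
      using V W P Q by (simp add: WV assoc_mult_mat[of _ n n _ n _ n])
    finally show ?thesis .
  qed
  show ?thesis
    using two[OF A B] two[of "A * B" C] A B C by simp
qed

(* The scalar field is the reals or the complex numbers: both are instances of the sort below,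
   and every real normed field is isomorphic, as a field, to one of them. The library's
   conjugate is the identity on the reals and cnj on the complex numbers. *)
theorem mainTheorem3:
  fixes n :: nat
    and \<phi> :: "nat \<Rightarrow> 'a::{real_normed_field, conjugatable_ordered_field} poly"
    and D V J Dp :: "'a mat"
  assumes "poly_basis n \<phi>"
  defines "D \<equiv> diff_mat n \<phi>"
    and "V \<equiv> monomial_mat n \<phi>"
    and "J \<equiv> superdiag_mat n"
    and "Dp \<equiv> V * moore_penrose_inverse J * the (mat_inverse V)"
  shows "invertible_mat V \<and> Dp * D * Dp = Dp \<and> D * Dp * D = D"
proof -
  have V: "V \<in> carrier_mat (Suc n) (Suc n)" and J: "J \<in> carrier_mat (Suc n) (Suc n)"
    by (simp_all add: V_def J_def monomial_mat_carrier superdiag_mat_carrier)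
  obtain W where W: "W \<in> carrier_mat (Suc n) (Suc n)" and VW: "V * W = 1\<^sub>m (Suc n)"
    unfolding V_def by (rule monomial_mat_right_inverse[OF assms(1)])
  have WV: "W * V = 1\<^sub>m (Suc n)"
    by (rule mat_mult_left_right_inverse[OF V W VW])
  have "invertible_mat V"
    using V W VW WV by (auto simp: invertible_mat_def inverts_mat_def)
  moreover have mp: "is_moore_penrose J (transpose_mat J)"
    unfolding J_def by (rule is_moore_penrose_superdiag_mat)
  moreover have D: "D = V * J * W"
    using diff_mat_monomial_mat[OF assms(1) W] VW by (simp add: D_def V_def J_def)
  \<comment> \<open>Both inverses inside \<open>Dp\<close> become explicit: the transpose for the
    shift and \<open>W\<close> for \<open>V\<close>.\<close>
  moreover have Dp: "Dp = V * transpose_mat J * W"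
    by (simp add: Dp_def moore_penrose_inverse_eqI[OF mp] mat_inverse_of_right_inverse[OF V W VW])
  moreover have "transpose_mat J \<in> carrier_mat (Suc n) (Suc n)"
    using J by simp
  ultimately show ?thesis
    using J by (simp add: similar_mat_mult3[OF V W WV] is_moore_penrose_def)
qed

end
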